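(* For every fixed integer $k\ge 3$, there is a constant $c_k>0$ such that $f(s,k)\ge g(k)+\frac{c_k}{s}$ for all $s\ge 1$; that is, $f(s,k)\ge g(k)+\Theta(\frac1s)$.
   Context: Let $\Sigma_s=\{0,\ldots,s-1\}$ with its natural order. For a word $w$ (sequence), subwords are subsequences counted by position sets, monotone if non-decreasing or non-increasing; $m(k,w)$ is the number of monotone $k$-subwords. $f(s,k,n)=\min_{w\in(\Sigma_s)^n}m(k,w)/\binom nk$, $f(s,k)=\lim_{n\to\infty}f(s,k,n)$. $g(k,n)$ is the minimum over permutations $\pi$ of $[n]$ of $m(k,\pi)/\binom nk$, and $g(k)=\lim_{n\to\infty}g(k,n)$. *)

theory Defs
  imports Complex_Main "HOL-Combinatorics.Multiset_Permutations"
begin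

(* A subword is identified with its set of positions, so a constant subword,
   which is both non-decreasing and non-increasing, is counted once. *)
definition mono_subwords :: "nat \<Rightarrow> nat list \<Rightarrow> nat" where
  "mono_subwords k w =
     card {I. I \<subseteq> {..<length w} \<and> card I = k \<and> (mono_on I ((!) w) \<or> antimono_on I ((!) w))}"

definition words :: "nat \<Rightarrow> nat \<Rightarrow> nat list set" where
  "words s n = {w. set w \<subseteq> {0..<s} \<and> length w = n}"

definition f_fin :: "nat \<Rightarrow> nat \<Rightarrow> nat \<Rightarrow> real" where
  "f_fin s k n = Min ((\<lambda>w. real (mono_subwords k w) / real (n choose k)) ` words s n)"

definition f_lim :: "nat \<Rightarrow> nat \<Rightarrow> real" where
  "f_lim s k = lim (\<lambda>n. f_fin s k n)"

(* Permutations of [n] in one-line notation. *)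
definition g_fin :: "nat \<Rightarrow> nat \<Rightarrow> real" where
  "g_fin k n = Min ((\<lambda>w. real (mono_subwords k w) / real (n choose k)) ` permutations_of_set {1..n})"

definition g_lim :: "nat \<Rightarrow> real" where
  "g_lim k = lim (\<lambda>n. g_fin k n)"

end

theory Submission
  imports Defs "HOL-Library.Ramsey" "HOL-Library.Product_Lexorder"
begin

text \<open>
  Breaking ties between equal letters turns a word into a permutation and creates no new monotone
  set, so it is enough to destroy a \<open>c / s\<close> fraction of all \<open>k\<close>-sets. Cut the \<open>n = M L\<close> positions
  into \<open>M\<close> blocks, where \<open>M\<close> is a Ramsey number guaranteeing monotone \<open>k\<close>-sets. Every choice of
  one position per block contains a monotone \<open>k\<close>-set, hence at least \<open>L ^ k\<close> monotone \<open>k\<close>-sets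
  meet each block at most once. In such a set, a position \<open>x\<close> may be replaced by any two positions
  of its class (same letter, same block) if another position is dropped, and the set stays monotone.
  As there are only \<open>s M\<close> classes, convexity yields of order \<open>n ^ k / s\<close> monotone \<open>k\<close>-sets
  containing two positions of one class and otherwise avoiding their block. Each of these is
  destroyed by at least one of two tie-breaking rules, so one of the two rules destroys half of them.
\<close>

section \<open>Monotone position sets of functions on finite sets of positions\<close>

definition mono_or_anti :: "nat set \<Rightarrow> (nat \<Rightarrow> 'a::linorder) \<Rightarrow> bool" where
  "mono_or_anti I h \<longleftrightarrow> mono_on I h \<or> antimono_on I h"

text \<open>An arbitrary position set and an arbitrary linear order of values allow positions to be
  deleted and letters to be refined by tie-breakers without relabelling.\<close>

definition mono_sets :: "nat \<Rightarrow> nat set \<Rightarrow> (nat \<Rightarrow> 'a::linorder) \<Rightarrow> nat set set" where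
  "mono_sets k A h = {I. I \<subseteq> A \<and> card I = k \<and> mono_or_anti I h}"

lemma mono_subwords_eq: "mono_subwords k w = card (mono_sets k {..<length w} ((!) w))"
  by (simp add: mono_subwords_def mono_sets_def mono_or_anti_def)

lemma finite_mono_sets [simp]: "finite A \<Longrightarrow> finite (mono_sets k A h)"
  by (rule finite_subset[of _ "Pow A"]) (auto simp: mono_sets_def)

lemma card_mono_sets_le: "finite A \<Longrightarrow> card (mono_sets k A h) \<le> card A choose k"
  by (subst n_subsets[symmetric]) (auto simp: mono_sets_def intro!: card_mono)

lemma mono_or_anti_order_preserving:
  assumes "\<And>x y. x \<in> I \<Longrightarrow> y \<in> I \<Longrightarrow> h x \<le> h y \<Longrightarrow> h' x \<le> h' y" "mono_or_anti I h"
  shows "mono_or_anti I h'"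
  using assms unfolding mono_or_anti_def monotone_on_def by meson

lemma mono_or_anti_strict_mono_image:
  assumes "strict_mono_on J (e :: nat \<Rightarrow> nat)"
  shows "mono_or_anti (e ` J) h \<longleftrightarrow> mono_or_anti J (h \<circ> e)"
proof -
  have "e x \<le> e y \<longleftrightarrow> x \<le> y" if "x \<in> J" "y \<in> J" for x y
    using strict_mono_on_less_eq[OF assms that] .
  then show ?thesis
    by (auto simp: mono_or_anti_def monotone_on_def)
qed

text \<open>The increasing enumeration of \<open>A\<close> is an order isomorphism from
  \<open>{..<card A}\<close>, so taking images under it matches the monotone sets on both
  sides.\<close>

lemma mono_subwords_map_sorted_list_of_set:
  assumes "finite A"
  shows "mono_subwords k (map h (sorted_list_of_set A)) = card (mono_sets k A h)"
proof -
  define e where "e i = sorted_list_of_set A ! i" for i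
  let ?n = "card A"
  have sm: "strict_mono_on {..<?n} e"
    using sorted_wrt_nth_less[OF strict_sorted_list_of_set[of A]] assms
    by (auto simp: e_def strict_mono_on_def)
  have inj: "inj_on e {..<?n}"
    using sm by (rule strict_mono_on_imp_inj_on)
  have img: "e ` {..<?n} = A"
    using assms set_sorted_list_of_set[OF assms]
    by (auto simp: e_def set_conv_nth image_def)
  have mon: "mono_or_anti I ((!) (map h (sorted_list_of_set A))) \<longleftrightarrow> mono_or_anti (e ` I) h"
    if "I \<subseteq> {..<?n}" for I
  proof -
    have "mono_or_anti (e ` I) h \<longleftrightarrow> mono_or_anti I (h \<circ> e)"
      using sm that by (intro mono_or_anti_strict_mono_image) (auto simp: strict_mono_on_def)
    moreover have "map h (sorted_list_of_set A) ! i = (h \<circ> e) i" if "i \<in> I" for i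
      using \<open>I \<subseteq> {..<?n}\<close> that by (auto simp: e_def)
    ultimately show ?thesis
      by (auto simp: mono_or_anti_def monotone_on_def)
  qed
  have "bij_betw ((`) e) (mono_sets k {..<?n} ((!) (map h (sorted_list_of_set A)))) (mono_sets k A h)"
  proof (rule bij_betw_imageI)
    show "inj_on ((`) e) (mono_sets k {..<?n} ((!) (map h (sorted_list_of_set A))))"
      by (rule inj_onI) (use inj in \<open>auto simp: mono_sets_def inj_on_image_eq_iff\<close>)
    show "(`) e ` mono_sets k {..<?n} ((!) (map h (sorted_list_of_set A))) = mono_sets k A h"
    proof safe
      fix I assume "I \<in> mono_sets k {..<?n} ((!) (map h (sorted_list_of_set A)))"
      then show "e ` I \<in> mono_sets k A h"
        using img mon inj card_image[of e I] by (auto simp: mono_sets_def inj_on_subset)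
    next
      fix J assume J: "J \<in> mono_sets k A h"
      then obtain I where I: "I \<subseteq> {..<?n}" "J = e ` I"
        using img by (metis (no_types, lifting) mem_Collect_eq mono_sets_def subset_imageE)
      then have "I \<in> mono_sets k {..<?n} ((!) (map h (sorted_list_of_set A)))"
        using J mon card_image[OF inj_on_subset[OF inj I(1)]] by (auto simp: mono_sets_def)
      then show "J \<in> (`) e ` mono_sets k {..<?n} ((!) (map h (sorted_list_of_set A)))"
        using I by blast
    qed
  qed
  then show ?thesis
    by (simp add: mono_subwords_eq bij_betw_same_card)
qed

section \<open>The minima \<open>f_fin\<close> and \<open>g_fin\<close> in terms of
  functions\<close>

lemma f_fin_le:
  assumes "finite A" "card A = n" "h ` A \<subseteq> {..<s}"
  shows "f_fin s k n * real (n choose k) \<le> real (card (mono_sets k A h))"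
proof (cases "n choose k = 0")
  case False
  have "map h (sorted_list_of_set A) \<in> words s n"
    using assms by (auto simp: words_def)
  moreover have "finite (words s n)"
    unfolding words_def by (rule finite_lists_length_eq) simp
  ultimately have "f_fin s k n \<le> real (mono_subwords k (map h (sorted_list_of_set A))) / real (n choose k)"
    unfolding f_fin_def by (intro Min_le) auto
  then show ?thesis
    using False assms by (simp add: mono_subwords_map_sorted_list_of_set field_simps)
qed (simp del: binomial_eq_0_iff)

lemma f_fin_attained:
  assumes "s \<ge> 1"
  obtains h where "h ` {..<n} \<subseteq> {..<s}"
    "f_fin s k n = real (card (mono_sets k {..<n} h)) / real (n choose k)"
proof -
  have "finite (words s n)"
    unfolding words_def by (rule finite_lists_length_eq) simp
  moreover have "replicate n 0 \<in> words s n"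
    using assms by (auto simp: words_def)
  ultimately have "f_fin s k n \<in> (\<lambda>w. real (mono_subwords k w) / real (n choose k)) ` words s n"
    unfolding f_fin_def by (intro Min_in) auto
  then obtain w where "w \<in> words s n" "f_fin s k n = real (mono_subwords k w) / real (n choose k)"
    by blast
  then show thesis
    using that[of "(!) w"] by (force simp: mono_subwords_eq words_def)
qed

text \<open>Replacing each value by its rank among the values on \<open>A\<close> gives a
  permutation of \<open>{1..n}\<close> with the same order pattern, hence the same monotone sets.
  The value type stays open because lexicographic tuples are ranked later.\<close>

lemma g_fin_le:
  fixes h :: "nat \<Rightarrow> 'a::linorder"
  assumes "finite A" "card A = n" "inj_on h A"
  shows "g_fin k n * real (n choose k) \<le> real (card (mono_sets k A h))"
proof (cases "n choose k = 0")
  case False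
  define r where "r x = card {y \<in> A. h y \<le> h x}" for x
  have r_mono: "r x \<le> r y" if "h x \<le> h y" for x y
    unfolding r_def using assms that by (intro card_mono) auto
  have r_less: "r x < r y" if "h x < h y" "y \<in> A" for x y
  proof -
    have "y \<notin> {z \<in> A. h z \<le> h x}" "y \<in> {z \<in> A. h z \<le> h y}"
      using that by auto
    moreover have "{z \<in> A. h z \<le> h x} \<subseteq> {z \<in> A. h z \<le> h y}"
      using that by auto
    ultimately show ?thesis
      unfolding r_def using assms by (intro psubset_card_mono) auto
  qed
  have r_le_iff: "r x \<le> r y \<longleftrightarrow> h x \<le> h y" if "x \<in> A" "y \<in> A" for x y
    using r_mono r_less that by (meson linorder_not_le)
  have inj: "inj_on r A"
    using assms(3) r_le_iff unfolding inj_on_def by (metis order.antisym order.refl)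
  have "r x \<in> {1..n}" if "x \<in> A" for x
  proof -
    have "{y \<in> A. h y \<le> h x} \<noteq> {}" using that by auto
    then show ?thesis
      using assms by (auto simp: r_def Suc_le_eq card_gt_0_iff intro: card_mono)
  qed
  then have img: "r ` A = {1..n}"
    using inj assms by (intro card_subset_eq) (auto simp: card_image)
  have "mono_sets k A r = mono_sets k A h"
    unfolding mono_sets_def
    using mono_or_anti_order_preserving[of _ r h] mono_or_anti_order_preserving[of _ h r] r_le_iff
    by (metis (no_types, lifting) subset_iff)
  moreover have "map r (sorted_list_of_set A) \<in> permutations_of_set {1..n}"
    using assms img inj by (auto simp: permutations_of_set_def distinct_map)
  then have "g_fin k n \<le> real (mono_subwords k (map r (sorted_list_of_set A))) / real (n choose k)"
    unfolding g_fin_def by (intro Min_le) auto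
  ultimately show ?thesis
    using False assms by (simp add: mono_subwords_map_sorted_list_of_set field_simps)
qed (simp del: binomial_eq_0_iff)

lemma g_fin_attained:
  obtains h :: "nat \<Rightarrow> nat" where "inj_on h {..<n}"
    "g_fin k n = real (card (mono_sets k {..<n} h)) / real (n choose k)"
proof -
  have "g_fin k n \<in> (\<lambda>w. real (mono_subwords k w) / real (n choose k)) ` permutations_of_set {1..n}"
    unfolding g_fin_def by (intro Min_in) auto
  then obtain w where w: "w \<in> permutations_of_set {1..n}"
      "g_fin k n = real (mono_subwords k w) / real (n choose k)"
    by blast
  have "length w = n" "distinct w"
    using w(1) by (auto simp: permutations_of_set_def dest: distinct_card)
  then show thesis
    using that[of "(!) w"] w(2) by (auto simp: mono_subwords_eq inj_on_nth)
qed

section \<open>Monotonicity in the length and existence of the limits\<close>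

text \<open>Double counting: a \<open>k\<close>-subset of \<open>{..n}\<close> survives exactly
  \<open>Suc n - k\<close> of the one-point deletions, so the density on \<open>Suc n\<close> points
  is the average of the densities after one deletion.\<close>

lemma mono_sets_density_averaging:
  assumes "\<And>j. j \<le> n \<Longrightarrow> a * real (n choose k) \<le> real (card (mono_sets k ({..n} - {j}) h))"
    and "k \<le> n"
  shows "a \<le> real (card (mono_sets k {..n} h)) / real (Suc n choose k)"
proof -
  let ?S = "mono_sets k {..n} h"
  have "(\<Sum>j\<le>n. card (mono_sets k ({..n} - {j}) h)) = (\<Sum>j\<le>n. card {I \<in> ?S. j \<notin> I})"
    by (intro sum.cong arg_cong[of _ _ card]) (auto simp: mono_sets_def)
  also have "\<dots> = (\<Sum>I\<in>?S. card {j \<in> {..n}. j \<notin> I})"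
    by (rule sum_multicount_gen) auto
  also have "\<dots> = (\<Sum>I\<in>?S. Suc n - k)"
  proof (rule sum.cong)
    fix I assume "I \<in> ?S"
    then have "I \<subseteq> {..n}" "card I = k" by (auto simp: mono_sets_def)
    moreover have "{j \<in> {..n}. j \<notin> I} = {..n} - I" by auto
    ultimately show "card {j \<in> {..n}. j \<notin> I} = Suc n - k"
      by (simp add: card_Diff_subset finite_subset)
  qed simp
  finally have eq: "(\<Sum>j\<le>n. card (mono_sets k ({..n} - {j}) h)) = (Suc n - k) * card ?S"
    by simp
  have "real (Suc n) * (a * real (n choose k)) = (\<Sum>j\<le>n. a * real (n choose k))"
    by simp
  also have "\<dots> \<le> (\<Sum>j\<le>n. real (card (mono_sets k ({..n} - {j}) h)))"
    using assms(1) by (intro sum_mono) auto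
  also have "\<dots> = real (Suc n - k) * real (card ?S)"
    using eq by (metis of_nat_mult of_nat_sum)
  finally have "a * (real (Suc n) * real (n choose k)) \<le> real (Suc n - k) * real (card ?S)"
    by (simp add: mult_ac)
  \<comment> \<open>The same double count for all \<open>k\<close>-sets; it converts the
    normalisation for \<open>n\<close> into that for \<open>Suc n\<close>.\<close>
  moreover have "real (Suc n) * real (n choose k) = real (Suc n - k) * real (Suc n choose k)"
    using binomial_absorb_comp[of "Suc n" k] by (metis diff_Suc_1 of_nat_mult)
  ultimately have "real (Suc n - k) * (a * real (Suc n choose k)) \<le> real (Suc n - k) * real (card ?S)"
    by (simp add: mult_ac)
  then have "a * real (Suc n choose k) \<le> real (card ?S)"
    using assms(2) by (simp add: mult_le_cancel_left)
  moreover have "real (Suc n choose k) > 0"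
    using assms(2) by simp
  ultimately show ?thesis
    by (simp add: pos_le_divide_eq)
qed

lemma mono_sets_density_bounds:
  "0 \<le> real (card (mono_sets k {..<n} h)) / real (n choose k)"
  "real (card (mono_sets k {..<n} h)) / real (n choose k) \<le> 1"
  using card_mono_sets_le[of "{..<n}" k h] by (auto intro!: divide_le_eq_1[THEN iffD2])

text \<open>Deleting one position from an optimal word leaves a word over the same letters, so
  averaging over deletions makes the sequence non-decreasing; densities are at most 1.\<close>

lemma convergent_f_fin:
  assumes "s \<ge> 1"
  shows "convergent (f_fin s k)"
proof -
  have bounds: "0 \<le> f_fin s k n \<and> f_fin s k n \<le> 1" for n
    using f_fin_attained[OF assms, of n k] mono_sets_density_bounds by metis
  have "f_fin s k n \<le> f_fin s k (Suc n)" for n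
  proof (cases "k \<le> n")
    case True
    obtain h where h: "h ` {..<Suc n} \<subseteq> {..<s}"
      "f_fin s k (Suc n) = real (card (mono_sets k {..<Suc n} h)) / real (Suc n choose k)"
      using f_fin_attained[OF assms] .
    have "f_fin s k n * real (n choose k) \<le> real (card (mono_sets k ({..n} - {j}) h))" if "j \<le> n" for j
      using h(1) that by (intro f_fin_le) (auto simp: lessThan_Suc_atMost)
    from mono_sets_density_averaging[OF this True] show ?thesis
      using h(2) by (simp add: lessThan_Suc_atMost)
  next
    case False
    \<comment> \<open>Here \<open>n < k\<close>: the binomial coefficient is 0, and so is the
      quotient by the convention on division.\<close>
    then have "f_fin s k n = 0"
      using f_fin_attained[OF assms, of n k] by (metis binomial_eq_0 div_by_0 linorder_not_le of_nat_0)
    then show ?thesis using bounds by simp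
  qed
  then have "incseq (f_fin s k)"
    by (rule incseq_SucI)
  then show ?thesis
    using bounds incseq_convergent[of "f_fin s k" 1] unfolding convergent_def by metis
qed

lemma convergent_g_fin: "convergent (g_fin k)"
proof -
  have bounds: "0 \<le> g_fin k n \<and> g_fin k n \<le> 1" for n
    using g_fin_attained[of n k] mono_sets_density_bounds by metis
  have "g_fin k n \<le> g_fin k (Suc n)" for n
  proof (cases "k \<le> n")
    case True
    obtain h :: "nat \<Rightarrow> nat" where h: "inj_on h {..<Suc n}"
      "g_fin k (Suc n) = real (card (mono_sets k {..<Suc n} h)) / real (Suc n choose k)"
      using g_fin_attained .
    have "g_fin k n * real (n choose k) \<le> real (card (mono_sets k ({..n} - {j}) h))" if "j \<le> n" for j
      using h(1) that by (intro g_fin_le) (auto intro: inj_on_subset simp: lessThan_Suc_atMost)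
    from mono_sets_density_averaging[OF this True] show ?thesis
      using h(2) by (simp add: lessThan_Suc_atMost)
  next
    case False
    then have "g_fin k n = 0"
      using g_fin_attained[of n k] by (metis binomial_eq_0 div_by_0 linorder_not_le of_nat_0)
    then show ?thesis using bounds by simp
  qed
  then have "incseq (g_fin k)"
    by (rule incseq_SucI)
  then show ?thesis
    using bounds incseq_convergent[of "g_fin k" 1] unfolding convergent_def by metis
qed

section \<open>Ramsey numbers for monotone sets\<close>

lemma exists_mono_or_anti_subset:
  obtains M where "M \<ge> 1"
    "\<And>A (h :: nat \<Rightarrow> nat). finite A \<Longrightarrow> card A \<ge> M \<Longrightarrow> mono_sets k A h \<noteq> {}"
proof -
  obtain M where M: "M \<ge> 1" "\<And>(V::nat set) E. finite V \<and> card V \<ge> M \<longrightarrow>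
    (\<exists>R \<subseteq> V. card R = k \<and> clique R E \<or> card R = k \<and> indep R E)"
    using ramsey2[of k k] by metis
  have "mono_sets k A h \<noteq> {}" if A: "finite A" "card A \<ge> M" for A and h :: "nat \<Rightarrow> nat"
  proof -
    \<comment> \<open>The graph joins ascending pairs: \<open>h\<close> is non-decreasing on a
      clique and strictly decreasing on an independent set.\<close>
    define E where "E = {{x, y} | x y. x < y \<and> h x \<le> h y}"
    have E: "{x, y} \<in> E \<longleftrightarrow> h x \<le> h y" if "x < y" for x y
      using that by (auto simp: E_def doubleton_eq_iff)
    obtain R where R: "R \<subseteq> A" "card R = k" "clique R E \<or> indep R E"
      using M(2)[of A E] A by auto
    have "mono_on R h" if "clique R E"
      using that E unfolding clique_def monotone_on_def by (metis nat_less_le order_refl)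
    moreover have "antimono_on R h" if "indep R E"
      using that E unfolding indep_def monotone_on_def by (metis nat_le_linear nat_less_le)
    ultimately show ?thesis
      using R by (auto simp: mono_sets_def mono_or_anti_def)
  qed
  then show thesis using that M(1) by blast
qed

section \<open>Tie-breaking\<close>

text \<open>The first component is weakly monotone in the lexicographic pair, whatever the
  tie-breaker \<open>p\<close>.\<close>

lemma lex_mono_sets_subset: "mono_sets k A (\<lambda>x. (w x, p x)) \<subseteq> mono_sets k A w"
  using mono_or_anti_order_preserving[of _ "\<lambda>x. (w x, p x)" w]
  by (fastforce simp: mono_sets_def)

text \<open>The two tie-breaking rules disagree on \<open>x\<close> and \<open>x'\<close>, so \<open>w\<close> would be both non-decreasing and
  non-increasing on \<open>I\<close>, hence constant; but they agree on \<open>x\<close> and \<open>z\<close>, which lie in different blocks.\<close>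

lemma lex_not_both_mono_or_anti:
  fixes w :: "nat \<Rightarrow> nat"
  assumes I: "x \<in> I" "x' \<in> I" "z \<in> I"
    and x: "x \<noteq> x'" "w x = w x'" "x div L = x' div L" and z: "z div L \<noteq> x div L"
    and m1: "mono_or_anti I (\<lambda>x. (w x, x))"
    and m2: "mono_or_anti I (\<lambda>x. (w x, x div L, - int x))"
  shows False
  using I x z
proof (induction x x' rule: linorder_less_wlog)
  case (less x x')
  then have "\<not> antimono_on I (\<lambda>x. (w x, x))"
    by (fastforce simp: monotone_on_def)
  then have M: "mono_on I (\<lambda>x. (w x, x))"
    using m1 by (auto simp: mono_or_anti_def)
  have "\<not> mono_on I (\<lambda>x. (w x, x div L, - int x))"
    using less by (fastforce simp: monotone_on_def)
  then have A: "antimono_on I (\<lambda>x. (w x, x div L, - int x))"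
    using m2 by (auto simp: mono_or_anti_def)
  consider "x < z" | "z < x"
    using less.prems by (metis linorder_neqE_nat)
  then show ?case
  proof cases
    case 1
    then have "x div L < z div L"
      using less.prems div_le_mono[of x z L] by linarith
    then show ?thesis
      using monotone_onD[OF M less.prems(1,3)] monotone_onD[OF A less.prems(1,3)] 1 by auto
  next
    case 2
    then have "z div L < x div L"
      using less.prems div_le_mono[of z x L] by linarith
    then show ?thesis
      using monotone_onD[OF M less.prems(3,1)] monotone_onD[OF A less.prems(3,1)] 2 by auto
  qed
next
  case (sym a b)
  then show ?case by metis
qed simp

section \<open>Duplicating a position within its class\<close>

text \<open>On \<open>J\<close> the function \<open>h\<close> agrees with
  \<open>h \<circ> \<phi>\<close>, a monotone function composed with a non-decreasing map.\<close>

lemma mono_or_anti_reindex: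
  assumes "mono_or_anti I h" "\<phi> ` J \<subseteq> I" "mono_on J \<phi>" "\<And>y. y \<in> J \<Longrightarrow> h (\<phi> y) = h y"
  shows "mono_or_anti J h"
proof -
  have "h (\<phi> x) \<le> h (\<phi> y)" if "mono_on I h" "x \<in> J" "y \<in> J" "x \<le> y" for x y
    using that assms(2,3) by (auto simp: monotone_on_def image_subset_iff)
  moreover have "h (\<phi> y) \<le> h (\<phi> x)" if "antimono_on I h" "x \<in> J" "y \<in> J" "x \<le> y" for x y
    using that assms(2,3) by (auto simp: monotone_on_def image_subset_iff)
  ultimately show ?thesis
    using assms(1,4) unfolding mono_or_anti_def by (auto simp: monotone_on_def)
qed

text \<open>Collapsing the block of \<open>u\<close> to the point \<open>u\<close> is monotone and keeps all letters involved.\<close>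

lemma mono_or_anti_duplicate:
  fixes w :: "nat \<Rightarrow> nat"
  assumes "mono_or_anti (insert u Y) w" "Z \<subseteq> Y" "\<And>y. y \<in> Y \<Longrightarrow> y div L \<noteq> u div L"
    and "w x = w u" "w x' = w u" "x div L = u div L" "x' div L = u div L"
  shows "mono_or_anti (insert x (insert x' Z)) w"
proof (rule mono_or_anti_reindex[OF assms(1)])
  let ?\<phi> = "\<lambda>y. if y div L = u div L then u else y"
  show "?\<phi> ` insert x (insert x' Z) \<subseteq> insert u Y"
    using assms by auto
  have "?\<phi> y \<le> ?\<phi> y'" if "y \<le> y'" for y y'
    using that div_le_mono[of y y' L] div_le_mono[of y' u L] div_le_mono[of u y L]
    by (auto simp: not_le) (metis nat_le_linear)+
  then show "mono_on (insert x (insert x' Z)) ?\<phi>"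
    by (intro monotone_onI)
  show "w (?\<phi> y) = w y" if "y \<in> insert x (insert x' Z)" for y
    using that assms by auto
qed

section \<open>Counting monotone sets that meet each block at most once\<close>

text \<open>Double counting over the \<open>L ^ M\<close> choices of one position per block: each
  choice contains a set of \<open>?T\<close> by the Ramsey property, and each set of
  \<open>?T\<close> lies in at most \<open>L ^ (M - k)\<close> choices, since it fixes
  \<open>k\<close> of the chosen positions.\<close>

lemma card_transversal_mono_sets:
  fixes w :: "nat \<Rightarrow> nat"
  assumes M: "\<And>A (h :: nat \<Rightarrow> nat). finite A \<Longrightarrow> card A \<ge> M \<Longrightarrow> mono_sets k A h \<noteq> {}"
    and L: "L > 0"
  shows "L ^ k \<le> card {I \<in> mono_sets k {..<M * L} w. inj_on (\<lambda>x. x div L) I}"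
    (is "_ \<le> card ?T")
proof -
  define B where "B i = {i * L..<Suc i * L}" for i
  have B: "x \<in> B i \<longleftrightarrow> x div L = i" for x i
  proof -
    have "x div L = i \<longleftrightarrow> i \<le> x div L \<and> x div L < Suc i" by auto
    also have "\<dots> \<longleftrightarrow> i * L \<le> x \<and> x < Suc i * L"
      using L by (simp only: less_eq_div_iff_mult_less_eq div_less_iff_less_mult)
    finally show ?thesis by (simp add: B_def)
  qed
  have cardB: "card (B i) = L" for i
    by (simp add: B_def)
  define \<Phi> where "\<Phi> = PiE {..<M} B"
  have card\<Phi>: "card \<Phi> = L ^ M"
    by (simp add: \<Phi>_def card_PiE cardB)
  have \<Phi>div: "\<phi> i div L = i" if "\<phi> \<in> \<Phi>" "i < M" for \<phi> i
    using that B by (auto simp: \<Phi>_def PiE_def Pi_def)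
  have fin\<Phi>: "finite \<Phi>"
    unfolding \<Phi>_def by (intro finite_PiE) (auto simp: B_def)
  have finT: "finite ?T"
    by simp
  have cover: "\<Phi> \<subseteq> (\<Union>I\<in>?T. {\<phi> \<in> \<Phi>. I \<subseteq> \<phi> ` {..<M}})"
  proof
    fix \<phi> assume \<phi>: "\<phi> \<in> \<Phi>"
    have "inj_on \<phi> {..<M}"
      using \<Phi>div[OF \<phi>] by (metis inj_onI lessThan_iff)
    then have "card (\<phi> ` {..<M}) = M"
      by (simp add: card_image)
    then obtain I where I: "I \<in> mono_sets k (\<phi> ` {..<M}) w"
      using M[of "\<phi> ` {..<M}" w] by auto
    then have sub: "I \<subseteq> \<phi> ` {..<M}"
      by (simp add: mono_sets_def)
    have "\<phi> i < M * L" if "i < M" for i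
      using \<Phi>div[OF \<phi> that] that L by (metis div_less_iff_less_mult)
    then have "I \<in> mono_sets k {..<M * L} w"
      using I by (auto simp: mono_sets_def)
    moreover have "inj_on (\<lambda>x. x div L) I"
    proof (rule inj_onI)
      fix x y assume "x \<in> I" "y \<in> I" and eq: "x div L = y div L"
      then obtain i j where "x = \<phi> i" "y = \<phi> j" "i < M" "j < M"
        using sub by blast
      then show "x = y"
        using eq \<Phi>div[OF \<phi>] by simp
    qed
    ultimately show "\<phi> \<in> (\<Union>I\<in>?T. {\<phi> \<in> \<Phi>. I \<subseteq> \<phi> ` {..<M}})"
      using \<phi> sub by blast
  qed
  have kM: "k \<le> M" and fib: "card {\<phi> \<in> \<Phi>. I \<subseteq> \<phi> ` {..<M}} \<le> L ^ (M - k)" if "I \<in> ?T" for I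
  proof -
    let ?b = "\<lambda>x. x div L"
    have I: "I \<subseteq> {..<M * L}" "card I = k" "inj_on ?b I"
      using that by (auto simp: mono_sets_def)
    have bI: "?b ` I \<subseteq> {..<M}"
      using I(1) by (auto simp: less_mult_imp_div_less)
    have cbI: "card (?b ` I) = k"
      using I by (simp add: card_image)
    show "k \<le> M"
      using card_mono[OF _ bI] cbI by simp
    \<comment> \<open>In a block met by \<open>I\<close> the choice is forced to be the point of
      \<open>I\<close> there; the other \<open>M - k\<close> blocks stay free.\<close>
    define B' where "B' i = (if i \<in> ?b ` I then {the_inv_into I ?b i} else B i)" for i
    have "\<phi> i = the_inv_into I ?b i" if \<phi>: "\<phi> \<in> \<Phi>" "I \<subseteq> \<phi> ` {..<M}" "i \<in> ?b ` I" for \<phi> i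
    proof -
      obtain x where x: "x \<in> I" "i = x div L" using \<phi>(3) by auto
      then obtain j where "j < M" "x = \<phi> j" using \<phi>(2) by auto
      then have "\<phi> i = x" using x \<Phi>div[OF \<phi>(1)] by auto
      then show ?thesis
        using x the_inv_into_f_f[OF I(3)] by simp
    qed
    then have "{\<phi> \<in> \<Phi>. I \<subseteq> \<phi> ` {..<M}} \<subseteq> PiE {..<M} B'"
      by (auto simp: \<Phi>_def B'_def PiE_def Pi_def)
    moreover have "finite (PiE {..<M} B')"
      by (intro finite_PiE) (auto simp: B'_def B_def)
    ultimately have "card {\<phi> \<in> \<Phi>. I \<subseteq> \<phi> ` {..<M}} \<le> card (PiE {..<M} B')"
      by (rule card_mono[rotated])
    also have "\<dots> = (\<Prod>i<M. if i \<in> ?b ` I then 1 else L)"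
      by (auto simp: card_PiE B'_def cardB intro!: prod.cong)
    also have "\<dots> = (\<Prod>i\<in>{..<M} - ?b ` I. L)"
      by (intro prod.mono_neutral_cong_right) auto
    also have "\<dots> = L ^ (M - k)"
      using bI cbI by (simp add: card_Diff_subset finite_subset)
    finally show "card {\<phi> \<in> \<Phi>. I \<subseteq> \<phi> ` {..<M}} \<le> L ^ (M - k)" .
  qed
  have "L ^ M \<le> card (\<Union>I\<in>?T. {\<phi> \<in> \<Phi>. I \<subseteq> \<phi> ` {..<M}})"
    unfolding card\<Phi>[symmetric]
    by (rule card_mono[OF _ cover]) (use fin\<Phi> in auto)
  also have "\<dots> \<le> (\<Sum>I\<in>?T. card {\<phi> \<in> \<Phi>. I \<subseteq> \<phi> ` {..<M}})"
    by (rule card_UN_le[OF finT])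
  also have "\<dots> \<le> card ?T * L ^ (M - k)"
    using sum_bounded_above[of ?T "\<lambda>I. card {\<phi> \<in> \<Phi>. I \<subseteq> \<phi> ` {..<M}}" "L ^ (M - k)"] fib by simp
  finally have le: "L ^ M \<le> card ?T * L ^ (M - k)" .
  \<comment> \<open>A member of \<open>?T\<close> is needed to obtain \<open>k \<le> M\<close>; only
    then is \<open>M - k\<close> an untruncated difference, so that \<open>L ^ M\<close> splits and
    a factor cancels.\<close>
  moreover have "?T \<noteq> {}"
    using le L by (metis card.empty mult_0 not_le zero_less_power)
  then have "k \<le> M"
    using kM by blast
  ultimately have "L ^ k * L ^ (M - k) \<le> card ?T * L ^ (M - k)"
    by (simp flip: power_add)
  then show ?thesis
    using L by simp
qed

section \<open>Counting monotone sets destroyed by a tie-breaking rule\<close>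

text \<open>Convexity enters through a tangent line: a class with \<open>c\<close> members has
  \<open>c * (c - 1)\<close> ordered pairs, which is at least
  \<open>(2 * t - 1) * c - t\<^sup>2\<close>. Summing over classes turns the number of transversal
  monotone sets into a number of destroyed ones. The point of tangency \<open>t\<close> is left free
  and optimised later.\<close>

lemma card_killed_mono_sets:
  fixes w :: "nat \<Rightarrow> nat" and t :: real
  assumes k: "k \<ge> 3"
    and M: "\<And>A (h :: nat \<Rightarrow> nat). finite A \<Longrightarrow> card A \<ge> M \<Longrightarrow> mono_sets k A h \<noteq> {}"
    and L: "L > 0" and n: "n = M * L" and w: "w ` {..<n} \<subseteq> {..<s}" and t: "t \<ge> 1/2"
  defines "N \<equiv> mono_sets k {..<n} w -
    mono_sets k {..<n} (\<lambda>x. (w x, x)) \<inter> mono_sets k {..<n} (\<lambda>x. (w x, x div L, - int x))"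
  shows "(2 * t - 1) * real L ^ k - t\<^sup>2 * real (s * M) * real n ^ (k - 1) \<le> real (k\<^sup>2 * n * card N)"
proof -
  \<comment> \<open>An index \<open>p\<close> pairs a letter with a block number.
    \<open>Ys p\<close> holds what is left of a monotone set once its point of class
    \<open>p\<close> is taken out; \<open>Zs p\<close> drops one more point to make room for a
    second member of the class.\<close>
  define C where "C p = {x. x < n \<and> w x = fst p \<and> x div L = snd p}" for p
  define Ys where "Ys p = {Y. Y \<subseteq> {..<n} \<and> card Y = k - 1 \<and> (\<forall>y\<in>Y. y div L \<noteq> snd p) \<and>
    (\<exists>u\<in>C p. mono_or_anti (insert u Y) w)}" for p
  define Zs where "Zs p = {Z. card Z = k - 2 \<and> (\<exists>Y\<in>Ys p. Z \<subseteq> Y)}" for p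
  define P where "P = {..<s} \<times> {..<M}"
  have finC [simp]: "finite (C p)" for p
    by (simp add: C_def)
  have finYs [simp]: "finite (Ys p)" for p
    by (rule finite_subset[of _ "Pow {..<n}"]) (auto simp: Ys_def)
  have finZs [simp]: "finite (Zs p)" for p
    by (rule finite_subset[of _ "Pow {..<n}"]) (auto simp: Zs_def Ys_def)
  have finP [simp]: "finite P"
    by (simp add: P_def)
  have finN [simp]: "finite N"
    by (simp add: N_def)
  have inP: "(w x, x div L) \<in> P" if "x < n" for x
    using that w L n by (auto simp: P_def less_mult_imp_div_less)

  \<comment> \<open>A transversal monotone set is any of its points \<open>x\<close> together with
    the rest, which avoids the block of \<open>x\<close>; it is thus covered by the class of
    \<open>x\<close>.\<close>
  have total: "L ^ k \<le> (\<Sum>p\<in>P. card (C p) * card (Ys p))"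
  proof -
    let ?T = "{I \<in> mono_sets k {..<n} w. inj_on (\<lambda>x. x div L) I}"
    have "?T \<subseteq> (\<Union>p\<in>P. (\<lambda>(x, Y). insert x Y) ` (C p \<times> Ys p))"
    proof
      fix I assume I: "I \<in> ?T"
      then have I': "I \<subseteq> {..<n}" "card I = k" "mono_or_anti I w" "inj_on (\<lambda>x. x div L) I"
        by (auto simp: mono_sets_def)
      then have "I \<noteq> {}"
        using k by auto
      then obtain x where x: "x \<in> I" "x < n"
        using I'(1) by auto
      have "finite I"
        using I'(1) finite_subset by blast
      have ins: "insert x (I - {x}) = I"
        using x by auto
      have xC: "x \<in> C (w x, x div L)"
        using x by (simp add: C_def)
      have "I - {x} \<in> Ys (w x, x div L)"
        unfolding Ys_def mem_Collect_eq
      proof (intro conjI)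
        show "\<forall>y\<in>I - {x}. y div L \<noteq> snd (w x, x div L)"
          using I'(4) x by (auto simp: inj_on_def)
        show "\<exists>u\<in>C (w x, x div L). mono_or_anti (insert u (I - {x})) w"
          using xC I'(3) ins by metis
      qed (use I' x \<open>finite I\<close> in auto)
      then have "I \<in> (\<lambda>(x, Y). insert x Y) ` (C (w x, x div L) \<times> Ys (w x, x div L))"
        using xC ins by (intro image_eqI[of _ _ "(x, I - {x})"]) auto
      then show "I \<in> (\<Union>p\<in>P. (\<lambda>(x, Y). insert x Y) ` (C p \<times> Ys p))"
        using inP[OF x(2)] by blast
    qed
    then have "card ?T \<le> card (\<Union>p\<in>P. (\<lambda>(x, Y). insert x Y) ` (C p \<times> Ys p))"
      by (intro card_mono) auto
    also have "\<dots> \<le> (\<Sum>p\<in>P. card ((\<lambda>(x, Y). insert x Y) ` (C p \<times> Ys p)))"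
      by (rule card_UN_le) simp
    also have "\<dots> \<le> (\<Sum>p\<in>P. card (C p) * card (Ys p))"
      by (intro sum_mono order.trans[OF card_image_le]) (auto simp: card_cartesian_product)
    finally show ?thesis
      using card_transversal_mono_sets[of M k L w, OF M L] n by simp
  qed

  \<comment> \<open>A set in \<open>Ys p\<close> is recovered from a set in \<open>Zs p\<close> and
    the dropped point, for which there are at most \<open>n\<close> options.\<close>
  have Ys_Zs: "card (Ys p) \<le> card (Zs p) * n" for p
  proof -
    have "Ys p \<subseteq> (\<lambda>(Z, y). insert y Z) ` (Zs p \<times> {..<n})"
    proof
      fix Y assume Y: "Y \<in> Ys p"
      then have Y': "Y \<subseteq> {..<n}" "card Y = k - 1"
        by (auto simp: Ys_def)
      then have "Y \<noteq> {}"
        using k by auto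
      then obtain y where y: "y \<in> Y"
        by auto
      have "Y - {y} \<in> Zs p"
        using Y Y' y finite_subset[OF Y'(1)] by (auto simp: Zs_def)
      then show "Y \<in> (\<lambda>(Z, y). insert y Z) ` (Zs p \<times> {..<n})"
        using y Y'(1) by (intro image_eqI[of _ _ "(Y - {y}, y)"]) auto
    qed
    then have "card (Ys p) \<le> card ((\<lambda>(Z, y). insert y Z) ` (Zs p \<times> {..<n}))"
      by (intro card_mono) auto
    also have "\<dots> \<le> card (Zs p) * n"
      by (rule order.trans[OF card_image_le]) (auto simp: card_cartesian_product)
    finally show ?thesis .
  qed

  have Ys_le: "card (Ys p) \<le> n ^ (k - 1)" for p
  proof -
    have "card (Ys p) \<le> card {Y. Y \<subseteq> {..<n} \<and> card Y = k - 1}"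
      by (rule card_mono) (auto simp: Ys_def)
    also have "\<dots> = n choose (k - 1)"
      by (subst n_subsets) auto
    also have "\<dots> \<le> n ^ (k - 1)"
      by (metis binomial_fact_pow fact_ge_1 mult.right_neutral mult_le_mono2 order.trans)
    finally show ?thesis .
  qed

  have killed: "insert x (insert x' Z) \<in> N" "x \<notin> Z" "x' \<notin> Z"
    if xx'Z: "x \<in> C p" "x' \<in> C p - {x}" "Z \<in> Zs p" for p x x' Z
  proof -
    obtain Y u where Y: "Y \<in> Ys p" "Z \<subseteq> Y" "card Z = k - 2"
      and u: "u \<in> C p" "mono_or_anti (insert u Y) w"
      using xx'Z(3) by (auto simp: Zs_def Ys_def)
    have Yb: "y div L \<noteq> snd p" if "y \<in> Y" for y
      using Y(1) that by (auto simp: Ys_def)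
    show xZ: "x \<notin> Z" "x' \<notin> Z"
      using Yb Y(2) that(1,2) by (auto simp: C_def)
    have Zn: "Z \<subseteq> {..<n}" "finite Z"
      using Y(1,2) by (auto simp: Ys_def intro: finite_subset)
    have "mono_or_anti (insert x (insert x' Z)) w"
      using Yb that u Y(2)
      by (intro mono_or_anti_duplicate[OF u(2), of _ L]) (auto simp: C_def)
    moreover have "card (insert x (insert x' Z)) = k"
      using Y(3) xZ Zn that k by auto
    ultimately have "insert x (insert x' Z) \<in> mono_sets k {..<n} w"
      using Zn that by (auto simp: mono_sets_def C_def)
    \<comment> \<open>Here \<open>k \<ge> 3\<close> is essential: \<open>Z\<close> supplies the
      point \<open>z\<close> in another block that makes the two tie-breaking rules
      incompatible.\<close>
    moreover have "Z \<noteq> {}"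
      using Y(3) k by auto
    then obtain z where z: "z \<in> Z"
      by auto
    have "\<not> (mono_or_anti (insert x (insert x' Z)) (\<lambda>x. (w x, x)) \<and>
        mono_or_anti (insert x (insert x' Z)) (\<lambda>x. (w x, x div L, - int x)))"
      using lex_not_both_mono_or_anti[of x "insert x (insert x' Z)" x' z w L] that Yb[of z] z Y(2)
      by (auto simp: C_def)
    ultimately show "insert x (insert x' Z) \<in> N"
      by (auto simp: N_def mono_sets_def)
  qed

  \<comment> \<open>The triple \<open>(I, x, x')\<close> determines everything: \<open>x\<close>
    gives its class \<open>p\<close>, and \<open>Z\<close> is \<open>I\<close> without
    \<open>x\<close> and \<open>x'\<close>. Each \<open>I\<close> admits at most
    \<open>k\<^sup>2\<close> ordered pairs.\<close>
  have pairs: "(\<Sum>p\<in>P. card (C p) * (card (C p) - 1) * card (Zs p)) \<le> card N * k\<^sup>2"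
  proof -
    let ?S = "SIGMA p:P. (SIGMA x:C p. C p - {x}) \<times> Zs p"
    let ?f = "\<lambda>(p, (x, x'), Z). (insert x (insert x' Z), x, x')"
    have "(\<Sum>p\<in>P. card (C p) * (card (C p) - 1) * card (Zs p)) = card ?S"
      by (simp add: card_cartesian_product)
    also have "\<dots> \<le> card (SIGMA I:N. I \<times> I)"
    proof (rule card_inj_on_le)
      show "inj_on ?f ?S"
      proof (rule inj_onI)
        fix q q' assume q: "q \<in> ?S" "q' \<in> ?S" "?f q = ?f q'"
        obtain p x x' Z where p: "q = (p, (x, x'), Z)" by (metis prod.collapse)
        obtain p' y y' Z' where p': "q' = (p', (y, y'), Z')" by (metis prod.collapse)
        have S: "x \<in> C p" "x' \<in> C p - {x}" "Z \<in> Zs p" "x \<in> C p'" "x' \<in> C p' - {x}" "Z' \<in> Zs p'"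
          and eq: "y = x" "y' = x'" "insert x (insert x' Z) = insert x (insert x' Z')"
          using q unfolding p p' by auto
        have "p = p'"
          using S(1,4) by (auto simp: C_def prod_eq_iff)
        moreover have "Z = Z'"
          using killed(2,3)[OF S(1-3)] killed(2,3)[OF S(4-6)] eq(3) by auto
        ultimately show "q = q'"
          using p p' eq by simp
      qed
      show "?f ` ?S \<subseteq> (SIGMA I:N. I \<times> I)"
        using killed(1) by auto
      show "finite (SIGMA I:N. I \<times> I)"
        by (intro finite_SigmaI) (auto simp: N_def mono_sets_def intro: finite_subset)
    qed
    also have "\<dots> = (\<Sum>I\<in>N. card I * card I)"
      by (subst card_SigmaI)
        (auto simp: N_def mono_sets_def card_cartesian_product intro: finite_subset)
    also have "\<dots> = card N * k\<^sup>2"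
      by (simp add: N_def mono_sets_def power2_eq_square)
    finally show ?thesis .
  qed

  \<comment> \<open>The assumption \<open>t \<ge> 1/2\<close> makes the factor
    \<open>2 * t - 1\<close> non-negative; the subtracted sum runs over \<open>s * M\<close>
    classes.\<close>
  have "(2 * t - 1) * real L ^ k - t\<^sup>2 * real (s * M) * real n ^ (k - 1)
      \<le> (2 * t - 1) * real (\<Sum>p\<in>P. card (C p) * card (Ys p)) - t\<^sup>2 * real (\<Sum>p\<in>P. card (Ys p))"
  proof -
    have "real L ^ k \<le> real (\<Sum>p\<in>P. card (C p) * card (Ys p))"
      using total by (metis of_nat_le_iff of_nat_power)
    moreover have "(\<Sum>p\<in>P. card (Ys p)) \<le> s * M * n ^ (k - 1)"
      using sum_bounded_above[of P "\<lambda>p. card (Ys p)" "n ^ (k - 1)"] Ys_le by (simp add: P_def)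
    then have "real (\<Sum>p\<in>P. card (Ys p)) \<le> real (s * M) * real n ^ (k - 1)"
      by (metis of_nat_le_iff of_nat_mult of_nat_power)
    ultimately show ?thesis
      using t by (simp add: mult.assoc diff_mono mult_left_mono)
  qed
  also have "\<dots> = (\<Sum>p\<in>P. ((2 * t - 1) * real (card (C p)) - t\<^sup>2) * real (card (Ys p)))"
    by (simp add: sum_distrib_left sum_subtractf sum.distrib algebra_simps)
  also have "\<dots> \<le> (\<Sum>p\<in>P. real (card (C p) * (card (C p) - 1)) * real (card (Ys p)))"
  proof (intro sum_mono mult_right_mono)
    fix p
    \<comment> \<open>The tangent-line bound, which is \<open>(c - t)\<^sup>2 \<ge> 0\<close>
      rearranged for \<open>c = card (C p)\<close>.\<close>
    have "real (card (C p) * (card (C p) - 1)) = (real (card (C p)))\<^sup>2 - real (card (C p))"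
      by (cases "card (C p)") (auto simp: power2_eq_square algebra_simps)
    then show "(2 * t - 1) * real (card (C p)) - t\<^sup>2 \<le> real (card (C p) * (card (C p) - 1))"
      using zero_le_power2[of "real (card (C p)) - t"] by (simp add: power2_eq_square algebra_simps)
  qed simp
  also have "\<dots> \<le> (\<Sum>p\<in>P. real (card (C p) * (card (C p) - 1)) * real (card (Zs p) * n))"
    using Ys_Zs by (intro sum_mono mult_left_mono) (auto simp flip: of_nat_mult)
  also have "\<dots> = real ((\<Sum>p\<in>P. card (C p) * (card (C p) - 1) * card (Zs p)) * n)"
    by (simp add: sum_distrib_right mult.assoc)
  also have "\<dots> \<le> real (k\<^sup>2 * n * card N)"
    using mult_le_mono1[OF pairs, of n] by (simp only: of_nat_le_iff mult_ac)
  finally show ?thesis .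
qed

section \<open>Comparing the two densities and passing to the limit\<close>

text \<open>Both refinements of an optimal word are injective, so \<open>g_fin\<close> bounds their
  counts from below; on average they lose at least half of \<open>card N\<close>. The bound on
  \<open>L\<close> makes classes large enough on average for the tangent-line estimate to be
  positive.\<close>

lemma f_fin_ge_g_fin_blocks:
  assumes k: "k \<ge> 3" and s: "s \<ge> 1" and M1: "M \<ge> 1"
    and M: "\<And>A (h :: nat \<Rightarrow> nat). finite A \<Longrightarrow> card A \<ge> M \<Longrightarrow> mono_sets k A h \<noteq> {}"
    and L: "L \<ge> 2 * s * M ^ k"
  shows "g_fin k (M * L) + 1 / (4 * real k ^ 2 * real M ^ (2 * k + 1)) / real s \<le> f_fin s k (M * L)"
proof -
  define n where "n = M * L"
  obtain w where w: "w ` {..<n} \<subseteq> {..<s}"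
    "f_fin s k n = real (card (mono_sets k {..<n} w)) / real (n choose k)"
    using f_fin_attained[OF s] .
  let ?A = "mono_sets k {..<n} w" and ?A1 = "mono_sets k {..<n} (\<lambda>x. (w x, x))"
    and ?A2 = "mono_sets k {..<n} (\<lambda>x. (w x, x div L, - int x))"
  define N where "N = ?A - ?A1 \<inter> ?A2"
  have L0: "L > 0"
    using L s M1 by (metis bot_nat_0.not_eq_extremum le_zero_eq mult_is_0 not_one_le_zero power_not_zero zero_neq_numeral)
  have sub: "?A1 \<subseteq> ?A" "?A2 \<subseteq> ?A"
    by (rule lex_mono_sets_subset)+
  have "card ?A1 + card ?A2 = card (?A1 \<union> ?A2) + card (?A1 \<inter> ?A2)"
    by (rule card_Un_Int) auto
  also have "\<dots> \<le> card ?A + card (?A1 \<inter> ?A2)"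
    using sub by (intro add_right_mono card_mono) auto
  finally have "card ?A1 + card ?A2 \<le> card ?A + card (?A1 \<inter> ?A2)" .
  moreover have "?A1 \<inter> ?A2 \<subseteq> ?A"
    using sub by auto
  then have "card N + card (?A1 \<inter> ?A2) = card ?A"
    by (simp add: N_def card_Diff_subset card_mono)
  ultimately have "card ?A1 + card ?A2 + card N \<le> 2 * card ?A"
    by linarith
  moreover have "g_fin k n * real (n choose k) \<le> real (card ?A1)"
    by (rule g_fin_le) (auto simp: inj_on_def)
  moreover have "g_fin k n * real (n choose k) \<le> real (card ?A2)"
    by (rule g_fin_le) (auto simp: inj_on_def)
  ultimately have two: "2 * (g_fin k n * real (n choose k)) + real (card N) \<le> 2 * real (card ?A)"
    by linarith

  \<comment> \<open>This \<open>t\<close> maximises the quadratic lower bound of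
    \<open>card_killed_mono_sets\<close>: the subtracted term becomes \<open>t * real L ^ k\<close>,
    leaving \<open>(t - 1) * real L ^ k\<close>.\<close>
  define t where "t = real L / (real s * real M ^ k)"
  have t2: "t \<ge> 2"
  proof -
    have "real (2 * s * M ^ k) \<le> real L"
      using L by (rule of_nat_mono)
    then show ?thesis
      using s M1 by (simp add: t_def pos_le_divide_eq)
  qed
  have tsM: "t * (real (s * M) * real n ^ (k - 1)) = real L ^ k"
  proof -
    have "M ^ k = M * M ^ (k - 1)" "L ^ k = L * L ^ (k - 1)"
      using k by (metis Suc_diff_1 less_le_trans power_Suc zero_less_numeral)+
    then have "real M ^ k = real M * real M ^ (k - 1)" "real L ^ k = real L * real L ^ (k - 1)"
      by (metis of_nat_mult of_nat_power)+
    then show ?thesis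
      using s M1 by (simp add: t_def n_def power_mult_distrib)
  qed
  have "t / 2 * real L ^ k \<le> (t - 1) * real L ^ k"
    using t2 by (intro mult_right_mono) auto
  also have "\<dots> = (2 * t - 1) * real L ^ k - t\<^sup>2 * real (s * M) * real n ^ (k - 1)"
    using tsM by (simp add: power2_eq_square mult.assoc) (simp add: algebra_simps)
  also have "\<dots> \<le> real (k\<^sup>2 * n * card N)"
    unfolding N_def using t2 by (intro card_killed_mono_sets[OF k M L0 n_def w(1)]) auto
  finally have "real L * real L ^ k / (2 * (real s * real M ^ k)) \<le> real L * (real k ^ 2 * real M * real (card N))"
    by (simp add: t_def n_def mult_ac)
  then have N: "real L ^ k / (2 * (real s * real M ^ k)) \<le> real k ^ 2 * real M * real (card N)"
    using L0 by (simp flip: times_divide_eq_right)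
  have bin: "real (n choose k) \<le> real M ^ k * real L ^ k"
  proof -
    have "n choose k \<le> n ^ k"
      by (metis binomial_fact_pow fact_ge_1 mult.right_neutral mult_le_mono2 order.trans)
    then have "real (n choose k) \<le> real (n ^ k)"
      by (rule of_nat_mono)
    then show ?thesis
      by (simp add: n_def power_mult_distrib)
  qed
  \<comment> \<open>This makes \<open>n choose k\<close> positive, so that it can be divided by at
    the end.\<close>
  have kn: "k \<le> n"
  proof -
    obtain I where "I \<in> mono_sets k {..<M} (\<lambda>x. x)"
      using M[of "{..<M}" "\<lambda>x. x"] by auto
    then have "k \<le> M"
      using card_mono[of "{..<M}" I] by (auto simp: mono_sets_def)
    then show ?thesis
      using L0 by (metis Suc_leI mult.right_neutral mult_le_mono n_def One_nat_def)
  qed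
  \<comment> \<open>One factor 2 comes from \<open>t - 1 \<ge> t / 2\<close>, the other from
    averaging two rules; \<open>k\<^sup>2\<close> counts ordered pairs. The powers of
    \<open>M\<close> come from \<open>t\<close>, from \<open>n choose k \<le> n ^ k\<close> and from
    one factor \<open>n = M * L\<close>.\<close>
  let ?c = "1 / (4 * real k ^ 2 * real M ^ (2 * k + 1)) / real s"
  have pos: "real k > 0" "real M > 0" "real s > 0"
    using k M1 s by auto
  have "2 * ?c * real (n choose k) \<le> 2 * ?c * (real M ^ k * real L ^ k)"
    using bin by (intro mult_left_mono) auto
  also have "\<dots> = real L ^ k / (2 * (real s * real M ^ k)) / (real k ^ 2 * real M)"
  proof -
    have "real M ^ (2 * k + 1) = real M ^ k * real M ^ k * real M"
      by (simp add: power_add mult_2)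
    moreover have "real M ^ k \<noteq> 0"
      using pos by simp
    ultimately show ?thesis
      using pos by simp
  qed
  also have "\<dots> \<le> real (card N)"
    using N pos by (simp add: pos_divide_le_eq mult_ac)
  finally have "(g_fin k n + ?c) * real (n choose k) \<le> real (card ?A)"
    using two by (simp add: algebra_simps)
  then show ?thesis
    using kn w(2) by (simp add: pos_le_divide_eq n_def)
qed

theorem theorem5p1:
  fixes k :: nat
  assumes "k \<ge> 3"
  shows "\<exists>c::real. c > 0 \<and> (\<forall>s::nat. s \<ge> 1 \<longrightarrow> f_lim s k \<ge> g_lim k + c / real s)"
proof -
  obtain M where M1: "M \<ge> 1"
    and M: "\<And>A (h :: nat \<Rightarrow> nat). finite A \<Longrightarrow> card A \<ge> M \<Longrightarrow> mono_sets k A h \<noteq> {}"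
    using exists_mono_or_anti_subset[of k] by blast
  let ?c = "1 / (4 * real k ^ 2 * real M ^ (2 * k + 1))"
  have "g_lim k + ?c / real s \<le> f_lim s k" if s: "s \<ge> 1" for s
  proof (rule LIMSEQ_le)
    \<comment> \<open>The estimate covers only lengths divisible by \<open>M\<close>; as both limits
      exist, this subsequence suffices.\<close>
    have sm: "strict_mono (\<lambda>L. M * L)"
      using M1 by (auto simp: strict_mono_def)
    have "g_fin k \<longlonglongrightarrow> g_lim k"
      using convergent_g_fin[of k] by (simp add: convergent_LIMSEQ_iff g_lim_def)
    from LIMSEQ_subseq_LIMSEQ[OF this sm]
    show "(\<lambda>L. g_fin k (M * L) + ?c / real s) \<longlonglongrightarrow> g_lim k + ?c / real s"
      by (intro tendsto_add) (auto simp: o_def)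
    have "f_fin s k \<longlonglongrightarrow> f_lim s k"
      using convergent_f_fin[OF s, of k] by (simp add: convergent_LIMSEQ_iff f_lim_def)
    from LIMSEQ_subseq_LIMSEQ[OF this sm]
    show "(\<lambda>L. f_fin s k (M * L)) \<longlonglongrightarrow> f_lim s k"
      by (simp add: o_def)
    \<comment> \<open>The threshold for \<open>L\<close> depends on \<open>s\<close>, which is fixed
      here; the constant \<open>?c\<close> does not.\<close>
    show "\<exists>L0. \<forall>L\<ge>L0. g_fin k (M * L) + ?c / real s \<le> f_fin s k (M * L)"
      using f_fin_ge_g_fin_blocks[OF assms s M1 M] by blast
  qed
  moreover have "?c > 0"
    using assms M1 by auto
  ultimately show ?thesis
    by blast
qed

end
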